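(* Let $(\lambda_n)_{n\ge 1}$ be a sequence in $(0,1)$ with $\sum_{n\ge 1}\lambda_n=\lambda<1$, let $\varepsilon\in(0,1)$, and let $\tilde\Xi\subset\Xi$ be a (finite, nonempty) discrete training set. Consider the PAC probabilistic greedy algorithm described in the context, run with these $\lambda_n$, $\varepsilon$ and $\tilde \Xi$, producing random parameters $\xi_1,\xi_2,\dots\in\tilde\Xi$, random spaces $V_n=\mathrm{span}\{u(\xi_1),\dots,u(\xi_n)\}$ and random approximations $u_n(\xi)\in V_n$. Suppose that there is a constant $C\ge 1$, independent of $n$, $V_n$ and $\xi$, such that for all $n\ge 1$ the approximation $u_n$ is quasi-optimal: $$\|u(\xi)-u_n(\xi)\|_V\le C\,\|u(\xi)-P_{V_n}u(\xi)\|_V\qquad\text{for all }\xi\in\tilde\Xi .$$ Then the algorithm is a weak-greedy algorithm of parameter $\frac{\sqrt{1-\varepsilon}}{C}$ with probability at least $1-\lambda$, i.e. $$\mathbb{P}\left(\|u(\xi_n)-P_{V_{n-1}}u(\xi_n)\|_V\ \ge\ \frac{\sqrt{1-\varepsilon}}{C}\,\max_{\xi\in\tilde\Xi}\|u(\xi)-P_{V_{n-1}}u(\xi)\|_V,\ \ \forall n\ge 1\right)\ \ge\ 1-\lambda .$$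
   Context: $V$ is a Hilbert space with norm $\|\cdot\|_V$, $\Xi$ is a parameter set, $u:\Xi\to V$ is a given map, and $P_{W}$ denotes the orthogonal projection of $V$ onto a finite-dimensional subspace $W$. All random objects are defined on a probability space $(\Omega,\mathcal{F},\mathbb{P})$. PAC probabilistic greedy algorithm. Set $V_0=\{0\}$ and $u_0(\xi)=0$ for all $\xi$. For each $n\ge 1$: (1) Select a random parameter $\xi_n\in\tilde\Xi$, using random samples, which is a probably approximately correct (PAC) maximizer in relative precision, as defined below. (2) Set $V_n=\mathrm{span}\{u(\xi_1),\dots,u(\xi_n)\}$, and let $u_n(\xi)\in V_n$ be an approximation of $u(\xi)$ for each $\xi$. Probabilistic representation of the error. Let $\mathcal{G}_{n-1}$ be the $\sigma$-algebra generated by all the random samples used in steps $1,\dots,n-1$ ($\mathcal{G}_0$ trivial). The parameters $\xi_1,\dots,\xi_{n-1}$, and hence $V_{n-1}$, as well as $u_{n-1}(\xi)$, are completely determined by these samples ($\mathcal{G}_{n-1}$-measurable). For each $n\ge1$ and $\xi$ there is a real-valued random variable $Z_{n-1}(\xi)$ such that, almost surely, $$\mathbb{E}^{n-1}(Z_{n-1}(\xi)):=\mathbb{E}(Z_{n-1}(\xi)\mid\mathcal{G}_{n-1})=\|u(\xi)-u_{n-1}(\xi)\|_V^2 .$$ PAC selection. Let $\xi_n^\star\in\arg\max_{\xi\in\tilde\Xi}\mathbb{E}^{n-1}(Z_{n-1}(\xi))$. The parameter $\xi_n$ selected in step (1) satisfies $$\mathbb{P}\Big(\mathbb{E}^{n-1}(Z_{n-1}(\xi_n^\star))-\mathbb{E}^{n-1}(Z_{n-1}(\xi_n))\le\varepsilon\,\mathbb{E}^{n-1}(Z_{n-1}(\xi_n^\star))\Big)\ge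 1-\lambda_n ,$$ where $\mathbb{E}^{n-1}(Z_{n-1}(\xi_n))$ means the function $\xi\mapsto\mathbb{E}^{n-1}(Z_{n-1}(\xi))$ evaluated at the random point $\xi_n$ (and similarly for $\xi_n^\star$). *)

theory Defs
  imports "HOL-Probability.Probability"
begin

definition orth_proj :: "'v::real_inner set \<Rightarrow> 'v \<Rightarrow> 'v" where
  "orth_proj W x = (THE y. y \<in> W \<and> (\<forall>w\<in>W. orthogonal (x - y) w))"

text \<open>
  \<open>X k\<close> bundles all random samples drawn in step \<open>k\<close> into one random element of the measurable
  space \<open>S k\<close>. For \<open>n = 0\<close> the result is the trivial sigma-algebra on \<open>space M\<close>.
\<close>
definition sample_algebra ::
    "'w measure \<Rightarrow> (nat \<Rightarrow> 's measure) \<Rightarrow> (nat \<Rightarrow> 'w \<Rightarrow> 's) \<Rightarrow> nat \<Rightarrow> 'w measure" where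
  "sample_algebra M S X n =
     sigma (space M) (\<Union>k\<in>{1..n}. sets (vimage_algebra (space M) (X k) (S k)))"

definition cond_exp_err ::
    "'w measure \<Rightarrow> (nat \<Rightarrow> 's measure) \<Rightarrow> (nat \<Rightarrow> 'w \<Rightarrow> 's) \<Rightarrow> (nat \<Rightarrow> 'p \<Rightarrow> 'w \<Rightarrow> real)
      \<Rightarrow> nat \<Rightarrow> 'p \<Rightarrow> 'w \<Rightarrow> real" where
  "cond_exp_err M S X Z n \<xi> = real_cond_exp M (sample_algebra M S X n) (Z n \<xi>)"

definition greedy_space ::
    "('p \<Rightarrow> 'v::real_vector) \<Rightarrow> (nat \<Rightarrow> 'w \<Rightarrow> 'p) \<Rightarrow> nat \<Rightarrow> 'w \<Rightarrow> 'v set" where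
  "greedy_space u \<xi>s n \<omega> = span ((\<lambda>k. u (\<xi>s k \<omega>)) ` {1..n})"

text \<open>
  A run of the PAC probabilistic greedy algorithm on the training set \<open>T\<close>: \<open>\<xi>s n\<close> is the parameter
  selected in step \<open>n \<ge> 1\<close>, \<open>\<xi>max n\<close> is any maximizer of the (version of the) conditional
  expectation of \<open>Z (n - 1)\<close> over \<open>T\<close>, and \<open>un n \<xi>\<close> is the approximation of \<open>u \<xi>\<close> in
  \<open>greedy_space u \<xi>s n\<close>. Values of \<open>\<xi>s\<close>, \<open>\<xi>max\<close>, \<open>X\<close>, \<open>S\<close> and \<open>lam\<close> at index \<open>0\<close> are irrelevant.
\<close>
locale pac_greedy = prob_space M
  for M :: "'w measure" +
  fixes S :: "nat \<Rightarrow> 's measure"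
    and X :: "nat \<Rightarrow> 'w \<Rightarrow> 's"
    and \<Xi> T :: "'p set"
    and u :: "'p \<Rightarrow> 'v::{real_inner, complete_space}"
    and \<epsilon> :: real
    and lam :: "nat \<Rightarrow> real"
    and \<xi>s \<xi>max :: "nat \<Rightarrow> 'w \<Rightarrow> 'p"
    and un :: "nat \<Rightarrow> 'p \<Rightarrow> 'w \<Rightarrow> 'v"
    and Z :: "nat \<Rightarrow> 'p \<Rightarrow> 'w \<Rightarrow> real"
  assumes samples: "\<And>n. n \<ge> 1 \<Longrightarrow> X n \<in> measurable M (S n)"
    and selected: "\<And>n. n \<ge> 1 \<Longrightarrow> \<xi>s n \<in> measurable (sample_algebra M S X n) (count_space T)"
    and approx_measurable:
      "\<And>n \<xi>. \<xi> \<in> \<Xi> \<Longrightarrow> un n \<xi> \<in> borel_measurable (sample_algebra M S X n)"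
    and approx_0: "\<And>\<xi> \<omega>. \<xi> \<in> \<Xi> \<Longrightarrow> \<omega> \<in> space M \<Longrightarrow> un 0 \<xi> \<omega> = 0"
    and approx_in:
      "\<And>n \<xi> \<omega>. n \<ge> 1 \<Longrightarrow> \<xi> \<in> \<Xi> \<Longrightarrow> \<omega> \<in> space M \<Longrightarrow> un n \<xi> \<omega> \<in> greedy_space u \<xi>s n \<omega>"
    and Z_integrable: "\<And>n \<xi>. n \<ge> 1 \<Longrightarrow> \<xi> \<in> \<Xi> \<Longrightarrow> integrable M (Z (n - 1) \<xi>)"
    and Z_cond_exp: "\<And>n \<xi>. n \<ge> 1 \<Longrightarrow> \<xi> \<in> \<Xi> \<Longrightarrow>
      AE \<omega> in M. cond_exp_err M S X Z (n - 1) \<xi> \<omega> = (norm (u \<xi> - un (n - 1) \<xi> \<omega>))\<^sup>2"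
    and maximizer: "\<And>n \<omega>. n \<ge> 1 \<Longrightarrow> \<omega> \<in> space M \<Longrightarrow>
      is_arg_max (\<lambda>\<xi>. cond_exp_err M S X Z (n - 1) \<xi> \<omega>) (\<lambda>\<xi>. \<xi> \<in> T) (\<xi>max n \<omega>)"
    and pac: "\<And>n. n \<ge> 1 \<Longrightarrow>
      \<P>(\<omega> in M. cond_exp_err M S X Z (n - 1) (\<xi>max n \<omega>) \<omega>
                 - cond_exp_err M S X Z (n - 1) (\<xi>s n \<omega>) \<omega>
               \<le> \<epsilon> * cond_exp_err M S X Z (n - 1) (\<xi>max n \<omega>) \<omega>)
      \<ge> 1 - lam n"

end

(* On the event that every PAC selection succeeds, the conditional expectations coincide almost
   surely with the squared errors, so the selected error is at least sqrt (1 - \<epsilon>) times the maximal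
   one; best approximation bounds the maximal error below, quasi-optimality bounds the selected
   error above, and a union bound gives the probability. The final event is measurable
   because its n-th condition only depends on finitely many parameters with values in a finite set. *)

theory Submission
  imports Defs
begin

section \<open>Orthogonal projection onto finitely generated spans\<close>

text \<open>One Gram-Schmidt step per generator: the residual \<open>c\<close> of \<open>b\<close>
  modulo \<open>span B\<close> is orthogonal to \<open>span B\<close>, so the projection of
  \<open>x\<close> onto \<open>span B\<close> only has to be corrected by the component of
  \<open>x\<close> along \<open>c\<close>. The induction hypothesis serves both \<open>b\<close> and
  \<open>x\<close>, hence \<open>arbitrary: x\<close>.\<close>

lemma ex_orthogonal_projection_span_finite:
  fixes x :: "'v::real_inner"
  assumes "finite B"
  shows "\<exists>y\<in>span B. \<forall>w\<in>span B. orthogonal (x - y) w"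
  using assms
proof (induction B arbitrary: x rule: finite_induct)
  case empty
  then show ?case by (simp add: orthogonal_def)
next
  case (insert b B)
  obtain p where p: "p \<in> span B" "\<And>w. w \<in> span B \<Longrightarrow> orthogonal (b - p) w"
    using insert.IH by blast
  obtain q where q: "q \<in> span B" "\<And>w. w \<in> span B \<Longrightarrow> orthogonal (x - q) w"
    using insert.IH by blast
  define c where "c = b - p"
  define y where "y = q + (x \<bullet> c / (c \<bullet> c)) *\<^sub>R c"
  have sub: "span B \<subseteq> span (insert b B)"
    by (rule span_mono) auto
  have "c \<in> span (insert b B)"
    unfolding c_def using p(1) sub by (intro span_diff) (auto intro: span_base)
  then have y: "y \<in> span (insert b B)"
    unfolding y_def using q(1) sub by (auto intro: span_add span_scale)
  \<comment> \<open>Since \<open>q\<close> is orthogonal to \<open>c\<close>, the coefficient in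
    \<open>y\<close> removes exactly the part of \<open>x\<close> along \<open>c\<close>. If
    \<open>c = 0\<close>, i.e. \<open>b\<close> already lies in \<open>span B\<close>, the claim is
    trivial.\<close>
  have orth_c: "orthogonal (x - y) c"
    using p(2)[OF q(1)] unfolding y_def
    by (cases "c = 0") (simp_all add: orthogonal_def inner_diff_left inner_add_left
        inner_commute[of q c] flip: c_def)
  have orth_B: "orthogonal (x - y) w" if "w \<in> span B" for w
    using p(2)[OF that] q(2)[OF that] unfolding y_def
    by (simp add: orthogonal_def inner_diff_left inner_add_left flip: c_def)
  \<comment> \<open>Here \<open>b = c + p\<close> with \<open>p\<close> in
    \<open>span B\<close>.\<close>
  have "orthogonal (x - y) b"
    using orth_c orth_B[OF p(1)] by (simp add: orthogonal_def c_def inner_diff_right)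
  then have "orthogonal (x - y) w" if "w \<in> span (insert b B)" for w
    using that orth_B by (intro orthogonal_to_span[of w "insert b B"]) (auto simp: span_base)
  with y show ?case by blast
qed

text \<open>Justifies the definite description in \<open>orth_proj\<close>: the difference of two
  candidates lies in the span and is orthogonal to itself, hence zero.\<close>

lemma orth_proj_span_finite:
  fixes x :: "'v::real_inner"
  assumes "finite B"
  shows orth_proj_in_span: "orth_proj (span B) x \<in> span B"
    and orth_proj_orthogonal: "w \<in> span B \<Longrightarrow> orthogonal (x - orth_proj (span B) x) w"
proof -
  have "\<exists>!y. y \<in> span B \<and> (\<forall>w\<in>span B. orthogonal (x - y) w)"
  proof (rule ex_ex1I)
    show "\<exists>y. y \<in> span B \<and> (\<forall>w\<in>span B. orthogonal (x - y) w)"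
      using ex_orthogonal_projection_span_finite[OF assms] by blast
  next
    fix y z
    assume y: "y \<in> span B \<and> (\<forall>w\<in>span B. orthogonal (x - y) w)"
      and z: "z \<in> span B \<and> (\<forall>w\<in>span B. orthogonal (x - z) w)"
    then have "y - z \<in> span B" by (auto intro: span_diff)
    with y z have "orthogonal ((x - z) - (x - y)) (y - z)"
      by (simp add: orthogonal_def inner_diff_left)
    then show "y = z" by (simp add: orthogonal_def)
  qed
  from theI'[OF this] show "orth_proj (span B) x \<in> span B"
    and "w \<in> span B \<Longrightarrow> orthogonal (x - orth_proj (span B) x) w"
    unfolding orth_proj_def by blast+
qed

text \<open>Pythagoras, applied to \<open>x - w\<close> split into the residual of \<open>x\<close>
  and a vector of the span.\<close>

lemma norm_diff_orth_proj_le: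
  fixes x :: "'v::real_inner"
  assumes "finite B" "w \<in> span B"
  shows "norm (x - orth_proj (span B) x) \<le> norm (x - w)"
proof -
  let ?p = "orth_proj (span B) x"
  have "orthogonal (x - ?p) (?p - w)"
    using assms by (intro orth_proj_orthogonal span_diff orth_proj_in_span)
  then have "(norm ((x - ?p) + (?p - w)))\<^sup>2 = (norm (x - ?p))\<^sup>2 + (norm (?p - w))\<^sup>2"
    by (rule norm_add_Pythagorean)
  then have "(norm (x - ?p))\<^sup>2 \<le> (norm (x - w))\<^sup>2" by simp
  then show ?thesis by (rule power2_le_imp_le) simp
qed

lemma orth_proj_zero_space: "orth_proj {0} x = 0"
  using orth_proj_in_span[of "{}" x] by simp

section \<open>Measurability and the union bound\<close>

lemma sets_sample_algebra_subset:
  assumes "\<And>k. k \<ge> 1 \<Longrightarrow> X k \<in> measurable M (S k)"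
  shows "sets (sample_algebra M S X n) \<subseteq> sets M"
proof -
  have *: "sets (vimage_algebra (space M) (X k) (S k)) \<subseteq> sets M" if "k \<in> {1..n}" for k
    using assms that by (intro sets_image_in_sets) auto
  then have "(\<Union>k\<in>{1..n}. sets (vimage_algebra (space M) (X k) (S k))) \<subseteq> sets M"
    by blast
  then show ?thesis
    using sets.space_closed[of M] unfolding sample_algebra_def
    by (subst sets_measure_of) (auto intro!: sets.sigma_sets_subset)
qed

lemma space_sample_algebra: "space (sample_algebra M S X n) = space M"
  unfolding sample_algebra_def using sets.sets_into_space
  by (intro space_measure_of) fastforce

text \<open>The restricted tuple takes only finitely many values, each with a measurable preimage,
  so any predicate of the tuple defines an event.\<close>

lemma sets_Collect_finite_family:
  assumes "finite K" "finite T"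
    and f: "\<And>k. k \<in> K \<Longrightarrow> f k \<in> measurable M (count_space T)"
  shows "{\<omega> \<in> space M. P (\<lambda>k\<in>K. f k \<omega>)} \<in> sets M"
proof -
  have "(\<lambda>\<omega>. \<lambda>k\<in>K. f k \<omega>) -` {h} \<inter> space M \<in> sets M"
    if h: "h \<in> PiE K (\<lambda>_. T)" for h
  proof -
    have "{\<omega> \<in> space M. f k \<omega> = h k} \<in> sets M" if "k \<in> K" for k
    proof -
      have "h k \<in> T" using h that by auto
      then have "f k -` {h k} \<inter> space M \<in> sets M"
        using f[OF that] by (intro measurable_sets) auto
      then show ?thesis
        by (simp add: vimage_def Int_def conj_commute)
    qed
    then have "{\<omega> \<in> space M. \<forall>k\<in>K. f k \<omega> = h k} \<in> sets M"
      using \<open>finite K\<close> by (rule sets.sets_Collect_finite_All)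
    \<comment> \<open>Both functions are \<open>undefined\<close> outside \<open>K\<close>, so
      agreement on \<open>K\<close> is equality.\<close>
    moreover have "(\<lambda>\<omega>. \<lambda>k\<in>K. f k \<omega>) -` {h} \<inter> space M = {\<omega> \<in> space M. \<forall>k\<in>K. f k \<omega> = h k}"
      using h by (auto simp: fun_eq_iff PiE_def extensional_def)
    ultimately show ?thesis by simp
  qed
  moreover have "(\<lambda>k\<in>K. f k \<omega>) \<in> PiE K (\<lambda>_. T)" if "\<omega> \<in> space M" for \<omega>
    using measurable_space[OF f] that by auto
  moreover have "finite (PiE K (\<lambda>_. T))"
    using assms by (intro finite_PiE)
  ultimately have "(\<lambda>\<omega>. \<lambda>k\<in>K. f k \<omega>) \<in> measurable M (count_space (PiE K (\<lambda>_. T)))"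
    by (subst measurable_count_space_eq2) blast+
  then have "(\<lambda>\<omega>. \<lambda>k\<in>K. f k \<omega>) -` {h \<in> PiE K (\<lambda>_. T). P h} \<inter> space M \<in> sets M"
    by (rule measurable_sets) auto
  also have "(\<lambda>\<omega>. \<lambda>k\<in>K. f k \<omega>) -` {h \<in> PiE K (\<lambda>_. T). P h} \<inter> space M
      = {\<omega> \<in> space M. P (\<lambda>k\<in>K. f k \<omega>)}"
    using measurable_space[OF f] by auto
  finally show ?thesis .
qed

text \<open>Countable subadditivity for the complements, whose probabilities are dominated by the
  summable sequence \<open>l\<close>.\<close>

lemma (in prob_space) prob_INT_ge:
  fixes A :: "nat \<Rightarrow> 'a set"
  assumes "\<And>n. A n \<in> events" and prob: "\<And>n. prob (A n) \<ge> 1 - l n" and l: "l sums L"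
  shows "prob (\<Inter>n. A n) \<ge> 1 - L"
proof -
  have le: "prob (space M - A n) \<le> l n" for n
    using prob[of n] by (simp add: prob_compl[OF assms(1)] algebra_simps)
  have sum: "summable (\<lambda>n. prob (space M - A n))"
    using le by (intro summable_comparison_test'[OF sums_summable[OF l], of 0]) auto
  have "prob (\<Union>n. space M - A n) \<le> (\<Sum>n. prob (space M - A n))"
    using assms(1) sum by (intro finite_measure_subadditive_countably) auto
  also have "\<dots> \<le> L"
    using suminf_le[OF le sum sums_summable[OF l]] sums_unique[OF l] by simp
  also have "(\<Union>n. space M - A n) = space M - (\<Inter>n. A n)" by auto
  finally show ?thesis
    using assms(1) prob_compl[of "\<Inter>n. A n"] by (simp add: sets.countable_INT'')
qed

section \<open>A single greedy step\<close>

context pac_greedy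
begin

lemma selected_measurable:
  assumes "n \<ge> 1"
  shows "\<xi>s n \<in> measurable M (count_space T)"
  using selected[OF assms] sets_sample_algebra_subset[of X M S n, OF samples]
  by (auto simp: measurable_def space_sample_algebra)

lemma selected_in: "n \<ge> 1 \<Longrightarrow> \<omega> \<in> space M \<Longrightarrow> \<xi>s n \<omega> \<in> T"
  using measurable_space[OF selected_measurable] by auto

lemma greedy_projection_best:
  assumes "\<xi> \<in> \<Xi>" "\<omega> \<in> space M"
  shows "norm (u \<xi> - orth_proj (greedy_space u \<xi>s n \<omega>) (u \<xi>)) \<le> norm (u \<xi> - un n \<xi> \<omega>)"
proof -
  \<comment> \<open>For \<open>n = 0\<close> the space is the span of the empty set, and
    \<open>un 0\<close> is zero.\<close>
  have "un n \<xi> \<omega> \<in> greedy_space u \<xi>s n \<omega>"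
    using approx_0[OF assms] approx_in[of n, OF _ assms]
    by (cases "n = 0") (auto simp: greedy_space_def)
  then show ?thesis
    unfolding greedy_space_def by (intro norm_diff_orth_proj_le) auto
qed

text \<open>Index \<open>n\<close> refers to the selection in step \<open>Suc n\<close>, made from
  the space of dimension at most \<open>n\<close>. This matches the series of
  \<open>lam (Suc n)\<close>; \<open>weak_greedy_step\<close> follows the same convention.\<close>

definition pac_event :: "nat \<Rightarrow> 'w set" where
  "pac_event n = {\<omega> \<in> space M.
     cond_exp_err M S X Z n (\<xi>max (Suc n) \<omega>) \<omega> - cond_exp_err M S X Z n (\<xi>s (Suc n) \<omega>) \<omega>
       \<le> \<epsilon> * cond_exp_err M S X Z n (\<xi>max (Suc n) \<omega>) \<omega>}"

definition weak_greedy_step :: "real \<Rightarrow> nat \<Rightarrow> 'w \<Rightarrow> bool" where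
  "weak_greedy_step \<gamma> n \<omega> \<longleftrightarrow>
     \<gamma> * (MAX \<xi>\<in>T. norm (u \<xi> - orth_proj (greedy_space u \<xi>s n \<omega>) (u \<xi>)))
       \<le> norm (u (\<xi>s (Suc n) \<omega>) - orth_proj (greedy_space u \<xi>s n \<omega>) (u (\<xi>s (Suc n) \<omega>)))"

lemma sets_weak_greedy_step:
  assumes "finite T"
  shows "{\<omega> \<in> space M. weak_greedy_step \<gamma> n \<omega>} \<in> sets M"
proof -
  \<comment> \<open>Expresses the greedy space through the tuple of selected parameters, so that the
    whole condition becomes a predicate of that tuple. The tuple runs up to \<open>Suc n\<close> to
    include the newly selected parameter.\<close>
  define W where "W h = span ((\<lambda>k. u (h k)) ` {1..n})" for h :: "nat \<Rightarrow> 'p"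
  let ?P = "\<lambda>h. \<gamma> * (MAX \<xi>\<in>T. norm (u \<xi> - orth_proj (W h) (u \<xi>)))
      \<le> norm (u (h (Suc n)) - orth_proj (W h) (u (h (Suc n))))"
  have W: "W (\<lambda>k\<in>{1..Suc n}. \<xi>s k \<omega>) = greedy_space u \<xi>s n \<omega>" for \<omega>
    unfolding W_def greedy_space_def by (rule arg_cong[of _ _ span]) (auto intro!: image_cong)
  have "{\<omega> \<in> space M. ?P (\<lambda>k\<in>{1..Suc n}. \<xi>s k \<omega>)} \<in> sets M"
    using assms selected_measurable
    by (intro sets_Collect_finite_family[where P = ?P and T = T]) auto
  then show ?thesis
    unfolding weak_greedy_step_def W by simp
qed

text \<open>The deterministic core, at one fixed outcome where the error representation holds on
  \<open>T\<close>.\<close>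

lemma weak_greedy_step_of_pac:
  assumes "T \<subseteq> \<Xi>" "finite T" "T \<noteq> {}" "\<epsilon> < 1" "C > 0"
    and quasi_optimal: "\<And>\<xi>. \<xi> \<in> T \<Longrightarrow>
      norm (u \<xi> - un n \<xi> \<omega>) \<le> C * norm (u \<xi> - orth_proj (greedy_space u \<xi>s n \<omega>) (u \<xi>))"
    and \<omega>: "\<omega> \<in> pac_event n"
    and rep: "\<And>\<xi>. \<xi> \<in> T \<Longrightarrow> cond_exp_err M S X Z n \<xi> \<omega> = (norm (u \<xi> - un n \<xi> \<omega>))\<^sup>2"
  shows "weak_greedy_step (sqrt (1 - \<epsilon>) / C) n \<omega>"
proof -
  let ?E = "\<lambda>\<xi>. cond_exp_err M S X Z n \<xi> \<omega>"
  let ?d = "\<lambda>\<xi>. norm (u \<xi> - orth_proj (greedy_space u \<xi>s n \<omega>) (u \<xi>))"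
  let ?s = "\<xi>s (Suc n) \<omega>"
  have sp: "\<omega> \<in> space M" using \<omega> by (simp add: pac_event_def)
  have s: "?s \<in> T" using selected_in[OF _ sp] by simp
  have "(1 - \<epsilon>) * ?E (\<xi>max (Suc n) \<omega>) \<le> ?E ?s"
    using \<omega> by (simp add: pac_event_def algebra_simps)
  have bound: "sqrt (1 - \<epsilon>) * ?d \<xi> \<le> C * ?d ?s" if \<xi>: "\<xi> \<in> T" for \<xi>
  proof -
    have "?E \<xi> \<le> ?E (\<xi>max (Suc n) \<omega>)"
      using maximizer[of "Suc n", OF _ sp] \<xi> by (auto simp: is_arg_max_linorder)
    then have "(1 - \<epsilon>) * ?E \<xi> \<le> (1 - \<epsilon>) * ?E (\<xi>max (Suc n) \<omega>)"
      using \<open>\<epsilon> < 1\<close> by (intro mult_left_mono) auto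
    also have "\<dots> \<le> ?E ?s" by fact
    finally have "(1 - \<epsilon>) * (norm (u \<xi> - un n \<xi> \<omega>))\<^sup>2 \<le> (norm (u ?s - un n ?s \<omega>))\<^sup>2"
      using rep \<xi> s by simp
    from real_sqrt_le_mono[OF this]
    have "sqrt (1 - \<epsilon>) * norm (u \<xi> - un n \<xi> \<omega>) \<le> norm (u ?s - un n ?s \<omega>)"
      by (simp add: real_sqrt_mult)
    moreover have "sqrt (1 - \<epsilon>) * ?d \<xi> \<le> sqrt (1 - \<epsilon>) * norm (u \<xi> - un n \<xi> \<omega>)"
      using greedy_projection_best[of \<xi> \<omega> n] \<xi> sp assms(1,4) by (intro mult_left_mono) auto
    ultimately show ?thesis
      using quasi_optimal[OF s] by linarith
  qed
  \<comment> \<open>The maximal projection error is attained, possibly at a parameter other than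
    \<open>\<xi>max\<close>; \<open>bound\<close> covers every point of \<open>T\<close>.\<close>
  have "(MAX \<xi>\<in>T. ?d \<xi>) \<in> ?d ` T"
    using assms by (intro Max_in) auto
  then obtain \<xi> where \<xi>: "\<xi> \<in> T" "(MAX \<xi>\<in>T. ?d \<xi>) = ?d \<xi>" by blast
  show ?thesis
    using bound[OF \<xi>(1)] \<open>C > 0\<close> unfolding weak_greedy_step_def \<xi>(2)
    by (simp add: field_simps)
qed

end

section \<open>Passage to all steps simultaneously\<close>

theorem theorem3p4:
  fixes M :: "'w measure"
    and S :: "nat \<Rightarrow> 's measure"
    and X :: "nat \<Rightarrow> 'w \<Rightarrow> 's"
    and \<Xi> T :: "'p set"
    and u :: "'p \<Rightarrow> 'v::{real_inner, complete_space}"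
    and \<epsilon> lam_total C :: real
    and lam :: "nat \<Rightarrow> real"
    and \<xi>s \<xi>max :: "nat \<Rightarrow> 'w \<Rightarrow> 'p"
    and un :: "nat \<Rightarrow> 'p \<Rightarrow> 'w \<Rightarrow> 'v"
    and Z :: "nat \<Rightarrow> 'p \<Rightarrow> 'w \<Rightarrow> real"
  assumes "\<And>n. n \<ge> 1 \<Longrightarrow> lam n \<in> {0<..<1}"
    and "(\<lambda>n. lam (Suc n)) sums lam_total"
    and "lam_total < 1"
    and "\<epsilon> \<in> {0<..<1}"
    and "T \<subseteq> \<Xi>" and "finite T" and "T \<noteq> {}"
    and "pac_greedy M S X \<Xi> T u \<epsilon> lam \<xi>s \<xi>max un Z"
    and "C \<ge> 1"
    and quasi_optimal: "\<And>n \<xi> \<omega>. n \<ge> 1 \<Longrightarrow> \<xi> \<in> T \<Longrightarrow> \<omega> \<in> space M \<Longrightarrow>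
      norm (u \<xi> - un n \<xi> \<omega>) \<le> C * norm (u \<xi> - orth_proj (greedy_space u \<xi>s n \<omega>) (u \<xi>))"
  shows "\<P>(\<omega> in M. \<forall>n\<ge>1.
           norm (u (\<xi>s n \<omega>) - orth_proj (greedy_space u \<xi>s (n - 1) \<omega>) (u (\<xi>s n \<omega>)))
             \<ge> sqrt (1 - \<epsilon>) / C *
               (MAX \<xi>\<in>T. norm (u \<xi> - orth_proj (greedy_space u \<xi>s (n - 1) \<omega>) (u \<xi>))))
         \<ge> 1 - lam_total"
proof -
  interpret pac_greedy M S X \<Xi> T u \<epsilon> lam \<xi>s \<xi>max un Z by fact
  let ?\<gamma> = "sqrt (1 - \<epsilon>) / C"
  let ?G = "{\<omega> \<in> space M. \<forall>n. weak_greedy_step ?\<gamma> n \<omega>}"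
  have pac_prob: "prob (pac_event n) \<ge> 1 - lam (Suc n)" for n
    using pac[of "Suc n"] by (simp add: pac_event_def)
  \<comment> \<open>\<open>prob\<close> vanishes on non-measurable sets, so positive probability gives measurability.\<close>
  have pac_sets: "pac_event n \<in> events" for n
    using pac_prob[of n] assms(1)[of "Suc n"] measure_notin_sets[of "pac_event n" M] by force
  have G: "?G \<in> events"
    using sets_weak_greedy_step[OF \<open>finite T\<close>] by (intro sets.sets_Collect_countable_All)
  \<comment> \<open>Countably many \<open>n\<close> and finitely many \<open>\<xi>\<close> leave a
    single null set to discard.\<close>
  have "AE \<omega> in M. \<forall>n. \<forall>\<xi>\<in>T. cond_exp_err M S X Z n \<xi> \<omega> = (norm (u \<xi> - un n \<xi> \<omega>))\<^sup>2"
    using Z_cond_exp[of "Suc _"] \<open>T \<subseteq> \<Xi>\<close> \<open>finite T\<close>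
    by (intro AE_all_countable[THEN iffD2] allI AE_finite_allI) auto
  then have AE: "AE \<omega> in M. \<omega> \<in> (\<Inter>n. pac_event n) \<longrightarrow> \<omega> \<in> ?G"
  proof (rule AE_mp, intro AE_I2 impI CollectI conjI allI)
    fix \<omega> n
    assume \<omega>: "\<omega> \<in> space M" "\<omega> \<in> (\<Inter>n. pac_event n)"
      and rep: "\<forall>n. \<forall>\<xi>\<in>T. cond_exp_err M S X Z n \<xi> \<omega> = (norm (u \<xi> - un n \<xi> \<omega>))\<^sup>2"
    have "norm (u \<xi> - un n \<xi> \<omega>) \<le> C * norm (u \<xi> - orth_proj (greedy_space u \<xi>s n \<omega>) (u \<xi>))"
      if \<xi>: "\<xi> \<in> T" for \<xi>
    \<comment> \<open>Quasi-optimality is assumed from index 1 on. At index 0 both the approximation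
      and the projection onto the zero space vanish, and \<open>C \<ge> 1\<close> gives the
      bound.\<close>
    proof (cases "n = 0")
      case True
      have "norm (u \<xi>) \<le> C * norm (u \<xi>)"
        using \<open>C \<ge> 1\<close> mult_right_mono[of 1 C "norm (u \<xi>)"] by simp
      then show ?thesis
        using True approx_0[of \<xi> \<omega>] \<xi> \<omega>(1) \<open>T \<subseteq> \<Xi>\<close>
        by (auto simp: greedy_space_def orth_proj_zero_space)
    next
      case False
      then show ?thesis using quasi_optimal \<xi> \<omega>(1) by simp
    qed
    then show "weak_greedy_step ?\<gamma> n \<omega>"
      using assms(4-7) \<open>C \<ge> 1\<close> \<omega>(2) rep by (intro weak_greedy_step_of_pac) auto
  qed
  have "1 - lam_total \<le> prob (\<Inter>n. pac_event n)"
    using pac_sets pac_prob assms(2) by (rule prob_INT_ge)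
  also have "\<dots> \<le> prob ?G"
    using AE G by (rule finite_measure_mono_AE)
  \<comment> \<open>Undoes the index shift: step \<open>n \<ge> 1\<close> of the claim is
    \<open>weak_greedy_step\<close> at \<open>n - 1\<close>.\<close>
  also have "?G = {\<omega> \<in> space M. \<forall>n\<ge>1.
      norm (u (\<xi>s n \<omega>) - orth_proj (greedy_space u \<xi>s (n - 1) \<omega>) (u (\<xi>s n \<omega>)))
        \<ge> ?\<gamma> * (MAX \<xi>\<in>T. norm (u \<xi> - orth_proj (greedy_space u \<xi>s (n - 1) \<omega>) (u \<xi>)))}"
  proof -
    have "(\<forall>n\<ge>1. Q n) \<longleftrightarrow> (\<forall>n. Q (Suc n))" for Q :: "nat \<Rightarrow> bool"
      by (auto dest: Suc_le_D)
    then show ?thesis unfolding weak_greedy_step_def by simp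
  qed
  finally show ?thesis .
qed

end
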